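(* Let $(x^k)_{k\in\mathbb{N}}$ be the sequence generated by the PSS Method with exogenous stepsizes, i.e. $\alpha_k=\beta_k/\eta_k$ with $\eta_k:=\max\{1,\|u^k\|\}$, $\beta_k>0$ for all $k$, $\sum_{k=0}^\infty\beta_k^2<+\infty$ and $\sum_{k=0}^\infty\beta_k=+\infty$. Let $S_*$ be the set of minimizers of $f+g$ over $\mathcal{H}$. Then: (a) $\liminf_{k\to\infty}(f+g)(x^k)=\inf_{x\in\mathcal{H}}(f+g)(x)$ (possibly equal to $-\infty$). (b) If $S_*\ne\emptyset$, then $\lim_{k\to\infty}(f+g)(x^k)=\min_{x\in\mathcal{H}}(f+g)(x)$ and $(x^k)_{k\in\mathbb{N}}$ converges weakly to some $\bar x\in S_*$. (c) If $S_*=\emptyset$, then $(x^k)_{k\in\mathbb{N}}$ is unbounded.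
   Context: Setting. $\mathcal{H}$ is a nontrivial real Hilbert space; $f,g:\mathcal{H}\to\mathbb{R}\cup\{+\infty\}$ are proper, lower semicontinuous and convex, with $\operatorname{dom}(g)\subseteq\operatorname{dom}(f)$, where $\operatorname{dom}(h)=\{x: h(x)<+\infty\}$. $\partial$ denotes the convex subdifferential, $\mathbb{N}=\{0,1,2,\dots\}$, and $\mathbb{B}[0;r]$ is the closed ball of radius $r$ centered at $0$. Standing assumptions: A1: $\partial f$ is bounded on bounded sets of $\operatorname{dom}(g)$: for every bounded and closed $V\subseteq\operatorname{dom}(g)$ there is $\zeta>0$ with $\partial f(x)\subseteq\mathbb{B}[0;\zeta]$ for all $x\in V$. A2: there is $\rho\ge 0$ such that $\partial g(x)\cap\mathbb{B}[0;\rho]\ne\emptyset$ for all $x\in\operatorname{dom}(g)$. For $\alpha>0$, $\operatorname{prox}_{\alpha g}(z)$ is the unique minimizer over $y\in\mathcal{H}$ of $\alpha g(y)+\frac12\|y-z\|^2$. PSS Method (Proximal Subgradient Splitting Method): take $x^0\in\operatorname{dom}(g)$ and, for $k\in\mathbb{N}$, set $x^{k+1}=\operatorname{prox}_{\alpha_k g}(x^k-\alpha_k u^k)$, where $u^k\in\partial f(x^k)$ (assumed to exist) and the stepsize $\alpha_k$ is positive. The method stops if $x^{k+1}=x^k$; it is assumed that it never stops, so that $(x^k)_{k\in\mathbb{N}}$ is an infinite sequence. *)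

theory Defs
  imports "HOL-Analysis.Analysis"
begin

text \<open>
  Functions \<open>\<H> \<rightarrow> \<real> \<union> {+\<infinity>}\<close> are modelled as \<^typ>\<open>ereal\<close>-valued functions; the value \<open>-\<infinity>\<close> is
  excluded by \<open>proper\<close>.
\<close>

definition edom :: "('a \<Rightarrow> ereal) \<Rightarrow> 'a set" where
  "edom h = {x. h x < \<infinity>}"

definition proper :: "('a \<Rightarrow> ereal) \<Rightarrow> bool" where
  "proper h \<longleftrightarrow> (\<forall>x. h x \<noteq> -\<infinity>) \<and> edom h \<noteq> {}"

definition lsc :: "('a::topological_space \<Rightarrow> ereal) \<Rightarrow> bool" where
  "lsc h \<longleftrightarrow> (\<forall>x. h x \<le> Liminf (nhds x) h)"

definition econvex :: "('a::real_vector \<Rightarrow> ereal) \<Rightarrow> bool" where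
  "econvex h \<longleftrightarrow> (\<forall>x y t. 0 < t \<longrightarrow> t < 1 \<longrightarrow>
     h ((1 - t) *\<^sub>R x + t *\<^sub>R y) \<le> ereal (1 - t) * h x + ereal t * h y)"

text \<open>For proper \<open>h\<close> this set is empty at every point outside the domain of \<open>h\<close>.\<close>

definition subdifferential :: "('a::real_inner \<Rightarrow> ereal) \<Rightarrow> 'a \<Rightarrow> 'a set" where
  "subdifferential h x = {v. \<forall>y. h x + ereal (v \<bullet> (y - x)) \<le> h y}"

definition minimizers :: "('a \<Rightarrow> ereal) \<Rightarrow> 'a set" where
  "minimizers h = {x. \<forall>y. h x \<le> h y}"

definition prox :: "real \<Rightarrow> ('a::real_inner \<Rightarrow> ereal) \<Rightarrow> 'a \<Rightarrow> 'a" where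
  "prox a h z =
     (THE y. y \<in> minimizers (\<lambda>w. ereal a * h w + ereal (1/2 * (norm (w - z))\<^sup>2)))"

text \<open>
  An infinite run of the method; the last conjunct says that the stopping test never succeeds.
\<close>

definition pss_sequence ::
  "('a::real_inner \<Rightarrow> ereal) \<Rightarrow> ('a \<Rightarrow> ereal) \<Rightarrow> (nat \<Rightarrow> real) \<Rightarrow> (nat \<Rightarrow> 'a) \<Rightarrow> (nat \<Rightarrow> 'a) \<Rightarrow> bool" where
  "pss_sequence f g \<alpha> u x \<longleftrightarrow>
     x 0 \<in> edom g \<and>
     (\<forall>k. \<alpha> k > 0 \<and>
          u k \<in> subdifferential f (x k) \<and>
          x (Suc k) = prox (\<alpha> k) g (x k - \<alpha> k *\<^sub>R u k) \<and>
          x (Suc k) \<noteq> x k)"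

definition weakly_converges :: "(nat \<Rightarrow> 'a::real_inner) \<Rightarrow> 'a \<Rightarrow> bool" where
  "weakly_converges x l \<longleftrightarrow> (\<forall>w. (\<lambda>k. x k \<bullet> w) \<longlonglongrightarrow> l \<bullet> w)"

end

theory Submission
  imports Defs
begin

text \<open>
  By A2, \<open>g\<close> is Lipschitz on its domain, which is therefore closed; hence the proximal points exist,
  and A1 bounds the subgradients \<open>u k\<close> along bounded iterates. The optimality condition of the proximal
  step gives, for every \<open>z\<close> in the domain of \<open>g\<close>,
  \<open>\<parallel>x (k+1) - z\<parallel>\<^sup>2 \<le> \<parallel>x k - z\<parallel>\<^sup>2 + 2 \<alpha> k (F z - F (x k)) + (1 + \<rho>)\<^sup>2 (\<beta> k)\<^sup>2\<close> with \<open>F = f + g\<close>.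
  If \<open>F (x k)\<close> stayed above some \<open>F z\<close> by a fixed amount, the iterates would be bounded and
  \<open>\<Sum>\<beta> k\<close> would converge, which proves (a). If \<open>z\<close> is a minimizer, the distances to it converge and the
  squared gaps \<open>(F (x k) - F z)\<^sup>2\<close> converge, necessarily to 0.
  Weak cluster points of a bounded sequence exist, and those along which \<open>F (x k)\<close> tends to
  the infimum are minimizers because the sublevel sets of \<open>F\<close> are weakly closed; this gives (c), and with
  Opial's argument (b). The Riesz representation theorem and projections onto closed convex sets are
  instances of the existence of proximal points.
\<close>

section \<open>Lower semicontinuity and convexity\<close>

lemma lsc_le_liminf:
  assumes "lsc h" "X \<longlonglongrightarrow> p"
  shows "h p \<le> liminf (\<lambda>n. h (X n))"
proof -
  have "eventually (\<lambda>n. y < h (X n)) sequentially" if "y < h p" for y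
  proof -
    have "eventually (\<lambda>z. y < h z) (nhds p)"
      using assms(1) that by (auto simp: lsc_def le_Liminf_iff)
    then show ?thesis using assms(2) by (rule eventually_compose_filterlim)
  qed
  then show ?thesis by (simp add: le_Liminf_iff)
qed

text \<open>Properness together with lower semicontinuity keeps both lower limits away from
  \<open>-\<infinity>\<close>, which is what superadditivity of \<open>liminf\<close>
  requires.\<close>

lemma closed_sublevel_add:
  fixes f g :: "'a::first_countable_topology \<Rightarrow> ereal"
  assumes "proper f" "lsc f" "proper g" "lsc g"
  shows "closed {z. f z + g z \<le> c}"
  unfolding closed_sequential_limits
proof safe
  fix X p assume X: "\<forall>n. X n \<in> {z. f z + g z \<le> c}" "X \<longlonglongrightarrow> p"
  have le: "f p \<le> liminf (\<lambda>n. f (X n))" "g p \<le> liminf (\<lambda>n. g (X n))"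
    using assms X(2) by (auto intro: lsc_le_liminf)
  have "f p \<noteq> -\<infinity>" "g p \<noteq> -\<infinity>"
    using assms by (auto simp: proper_def)
  then have ninf: "liminf (\<lambda>n. f (X n)) \<noteq> -\<infinity>" "liminf (\<lambda>n. g (X n)) \<noteq> -\<infinity>"
    using le by auto
  have "f p + g p \<le> liminf (\<lambda>n. f (X n)) + liminf (\<lambda>n. g (X n))"
    using le by (rule add_mono)
  also have "\<dots> \<le> liminf (\<lambda>n. f (X n) + g (X n))"
    using ninf by (intro ereal_liminf_add_mono) auto
  also have "\<dots> \<le> liminf (\<lambda>n. c)"
    using X(1) by (intro Liminf_mono) auto
  also have "\<dots> = c" by (simp add: Liminf_const)
  finally show "f p + g p \<le> c" .
qed

lemma econvex_ereal_bound:
  assumes "econvex h" "0 < t" "t < 1" "h y = ereal a" "h z = ereal b"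
  shows "h ((1 - t) *\<^sub>R y + t *\<^sub>R z) \<le> ereal ((1 - t) * a + t * b)"
proof -
  have "h ((1 - t) *\<^sub>R y + t *\<^sub>R z) \<le> ereal (1 - t) * h y + ereal t * h z"
    using assms(1-3) by (simp add: econvex_def)
  then show ?thesis by (simp add: assms(4,5))
qed

lemma convex_sublevel_add:
  assumes "proper f" "econvex f" "proper g" "econvex g"
  shows "convex {z. f z + g z \<le> ereal c}"
  unfolding convex_alt
proof safe
  fix y z :: 'a and t :: real
  assume y: "f y + g y \<le> ereal c" and z: "f z + g z \<le> ereal c" and t: "0 \<le> t" "t \<le> 1"
  have ninf: "f w \<noteq> -\<infinity>" "g w \<noteq> -\<infinity>" for w
    using assms by (auto simp: proper_def)
  obtain fy gy where fgy: "f y = ereal fy" "g y = ereal gy"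
    using y ninf[of y] by (cases "f y"; cases "g y") auto
  obtain fz gz where fgz: "f z = ereal fz" "g z = ereal gz"
    using z ninf[of z] by (cases "f z"; cases "g z") auto
  show "f ((1 - t) *\<^sub>R y + t *\<^sub>R z) + g ((1 - t) *\<^sub>R y + t *\<^sub>R z) \<le> ereal c"
  \<comment> \<open>\<open>econvex\<close> speaks only of \<open>0 < t\<close> and
    \<open>t < 1\<close>, so the endpoints are treated separately.\<close>
  proof (cases "t = 0 \<or> t = 1")
    case True
    then show ?thesis using y z by auto
  next
    case False
    with t have t: "0 < t" "t < 1" by auto
    have "f ((1 - t) *\<^sub>R y + t *\<^sub>R z) + g ((1 - t) *\<^sub>R y + t *\<^sub>R z)
        \<le> ereal ((1 - t) * fy + t * fz) + ereal ((1 - t) * gy + t * gz)"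
      using assms t fgy fgz by (intro add_mono econvex_ereal_bound)
    also have "\<dots> = ereal ((1 - t) * (fy + gy) + t * (fz + gz))"
      by (simp add: algebra_simps)
    also have "(1 - t) * (fy + gy) + t * (fz + gz) \<le> c"
      using y z t by (intro convex_bound_le) (auto simp: fgy fgz)
    finally show ?thesis by simp
  qed
qed

text \<open>The indicator function turns projection onto a closed convex set into an instance of
  \<open>prox\<close>.\<close>

lemma lsc_indicator_closed:
  assumes "closed C"
  shows "lsc (\<lambda>y. if y \<in> C then 0 else \<infinity>)"
proof -
  have "eventually (\<lambda>z. y < (if z \<in> C then 0 else \<infinity>)) (nhds w)"
    if "y < (if w \<in> C then 0 else \<infinity>)" for w and y :: ereal
  proof (cases "w \<in> C")
    case True
    with that have "y < 0" by simp
    then show ?thesis by (auto intro: order_less_le_trans intro!: always_eventually)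
  next
    case False
    with that have "y < \<infinity>" by simp
    have "eventually (\<lambda>z. z \<in> - C) (nhds w)"
      using False assms by (intro eventually_nhds_in_open) auto
    then show ?thesis
      by eventually_elim (use \<open>y < \<infinity>\<close> in auto)
  qed
  then show ?thesis by (simp add: lsc_def le_Liminf_iff)
qed

lemma subgradient_ineq:
  assumes "v \<in> subdifferential h z" "h z = ereal a" "h y = ereal b"
  shows "a + v \<bullet> (y - z) \<le> b"
proof -
  have "h z + ereal (v \<bullet> (y - z)) \<le> h y" using assms(1) by (simp add: subdifferential_def)
  then show ?thesis using assms by simp
qed

section \<open>The proximal operator\<close>

lemma parallelogram_midpoint:
  fixes y w z :: "'a::real_inner"
  shows "(norm ((1/2) *\<^sub>R y + (1/2) *\<^sub>R w - z))\<^sup>2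
    = 1/2 * (norm (y - z))\<^sup>2 + 1/2 * (norm (w - z))\<^sup>2 - 1/4 * (norm (y - w))\<^sup>2"
  unfolding power2_norm_eq_inner
  by (simp add: inner_diff_left inner_diff_right inner_add_left inner_add_right inner_commute
      field_simps)

text \<open>A minimizing sequence is Cauchy by strong convexity.\<close>

lemma prox_objective_has_minimizer:
  fixes h :: "'a::{real_inner, complete_space} \<Rightarrow> ereal"
  assumes h: "proper h" "lsc h" "econvex h" and a: "a > 0"
    and minorant: "R \<ge> 0" "\<And>y. ereal (c - R * norm y) \<le> h y"
  shows "\<exists>p. p \<in> edom h \<and> p \<in> minimizers (\<lambda>w. ereal a * h w + ereal (1/2 * (norm (w - z))\<^sup>2))"
proof -
  define hr where "hr y = real_of_ereal (h y)" for y
  have hr: "h y = ereal (hr y)" if "y \<in> edom h" for y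
    using h(1) that by (cases "h y") (auto simp: hr_def proper_def edom_def)
  define \<phi> where "\<phi> w = a * hr w + 1/2 * (norm (w - z))\<^sup>2" for w
  have \<phi>: "ereal a * h w + ereal (1/2 * (norm (w - z))\<^sup>2) = ereal (\<phi> w)" if "w \<in> edom h" for w
    using hr[OF that] by (simp add: \<phi>_def)
  \<comment> \<open>Completing the square in \<open>norm (w - z)\<close>; the quadratic lower bound
    is least where this norm equals \<open>a * R\<close>.\<close>
  define B where "B = a * c - a * R * norm z - 1/2 * (a * R)\<^sup>2"
  have lb: "B \<le> \<phi> w" if "w \<in> edom h" for w
  proof -
    have "norm w \<le> norm z + norm (w - z)" using norm_triangle_ineq[of z "w - z"] by simp
    then have "c - R * (norm z + norm (w - z)) \<le> c - R * norm w"
      using minorant(1) by (simp add: mult_left_mono)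
    also have "\<dots> \<le> hr w" using minorant(2)[of w] hr[OF that] by simp
    finally have "a * (c - R * (norm z + norm (w - z))) \<le> a * hr w" using a by simp
    moreover have "0 \<le> (norm (w - z) - a * R)\<^sup>2" by simp
    ultimately show ?thesis by (simp add: B_def \<phi>_def algebra_simps power2_eq_square)
  qed
  define m where "m = Inf (\<phi> ` edom h)"
  have bdd: "bdd_below (\<phi> ` edom h)" using lb by (auto simp: bdd_below_def)
  have ne: "\<phi> ` edom h \<noteq> {}" using h(1) by (auto simp: proper_def)
  have m: "m \<le> \<phi> w" if "w \<in> edom h" for w
    unfolding m_def using bdd that by (intro cInf_lower) auto
  have "\<exists>w\<in>edom h. \<phi> w < m + 1 / real (Suc n)" for n
    using cInf_lessD[OF ne, of "m + 1 / real (Suc n)"] by (auto simp: m_def)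
  then obtain X where X: "\<And>n. X n \<in> edom h" "\<And>n. \<phi> (X n) < m + 1 / real (Suc n)"
    by metis
  \<comment> \<open>The midpoint has value at least \<open>m\<close>, so strong convexity bounds the
    distance of two points by their excesses over \<open>m\<close>.\<close>
  have mid: "(norm (y - w))\<^sup>2 \<le> 4 * (\<phi> y - m) + 4 * (\<phi> w - m)"
    if "y \<in> edom h" "w \<in> edom h" for y w
  proof -
    let ?q = "(1/2) *\<^sub>R y + (1/2) *\<^sub>R w"
    have q: "h ?q \<le> ereal (1/2 * hr y + 1/2 * hr w)"
      using econvex_ereal_bound[OF h(3), of "1/2" y "hr y" w "hr w"] hr that by simp
    then have qd: "?q \<in> edom h" by (auto simp: edom_def intro: order_le_less_trans)
    have "hr ?q \<le> 1/2 * hr y + 1/2 * hr w" using q hr[OF qd] by simp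
    then have "a * hr ?q \<le> a * (1/2 * hr y + 1/2 * hr w)" using a by simp
    then have "\<phi> ?q \<le> 1/2 * \<phi> y + 1/2 * \<phi> w - 1/8 * (norm (y - w))\<^sup>2"
      unfolding \<phi>_def parallelogram_midpoint by (simp add: algebra_simps)
    with m[OF qd] show ?thesis by simp
  qed
  have "Cauchy X"
  proof (rule metric_CauchyI)
    fix e :: real assume "e > 0"
    then obtain N where N: "1 / real (Suc N) < e\<^sup>2 / 8"
      using nat_approx_posE[of "e\<^sup>2 / 8"] by auto
    have small: "\<phi> (X n) - m < e\<^sup>2 / 8" if "n \<ge> N" for n
    proof -
      have "1 / real (Suc n) \<le> 1 / real (Suc N)" using that by (simp add: frac_le)
      with X(2)[of n] N show ?thesis by linarith
    qed
    show "\<exists>M. \<forall>i\<ge>M. \<forall>j\<ge>M. dist (X i) (X j) < e"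
    proof (intro exI allI impI)
      fix i j assume ij: "N \<le> i" "N \<le> j"
      have "(norm (X i - X j))\<^sup>2 < e\<^sup>2"
        using mid[OF X(1) X(1), of i j] small[OF ij(1)] small[OF ij(2)] by argo
      then show "dist (X i) (X j) < e"
        using \<open>e > 0\<close> by (simp add: dist_norm power2_less_imp_less)
    qed
  qed
  then obtain p where p: "X \<longlonglongrightarrow> p" using Cauchy_convergent convergent_def by blast
  \<comment> \<open>A bound for every real \<open>b\<close> below \<open>h p\<close> treats finite
    and infinite \<open>h p\<close> alike; each case below picks its own \<open>b\<close>.\<close>
  have key: "a * b + 1/2 * (norm (p - z))\<^sup>2 \<le> m" if "ereal b < h p" for b
  proof -
    have "eventually (\<lambda>n. ereal b < h (X n)) sequentially"
      using lsc_le_liminf[OF h(2) p] that by (auto simp: le_Liminf_iff)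
    then have ev: "eventually (\<lambda>n. a * b + 1/2 * (norm (X n - z))\<^sup>2 \<le> m + 1 / real (Suc n)) sequentially"
    proof eventually_elim
      case (elim n)
      then have "a * b \<le> a * hr (X n)" using hr[OF X(1)] a by simp
      then show ?case using X(2)[of n] by (simp add: \<phi>_def)
    qed
    have "(\<lambda>n. a * b + 1/2 * (norm (X n - z))\<^sup>2) \<longlonglongrightarrow> a * b + 1/2 * (norm (p - z))\<^sup>2"
      by (intro tendsto_intros p)
    moreover have "(\<lambda>n. m + 1 / real (Suc n)) \<longlonglongrightarrow> m"
      using tendsto_add[OF tendsto_const[of m] LIMSEQ_Suc[OF lim_1_over_n]] by simp
    ultimately show ?thesis
      using ev by (intro tendsto_le[OF sequentially_bot]) auto
  qed
  have pd: "p \<in> edom h"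
  proof (rule ccontr)
    assume "p \<notin> edom h"
    then have "h p = \<infinity>" by (simp add: edom_def)
    \<comment> \<open>This \<open>b\<close> makes the left side at least
      \<open>m + 1\<close>.\<close>
    then have "a * ((m + 1) / a) + 1/2 * (norm (p - z))\<^sup>2 \<le> m" by (intro key) simp
    then have "m + 1 + 1/2 * (norm (p - z))\<^sup>2 \<le> m" using a by simp
    then show False using zero_le_power2[of "norm (p - z)"] by linarith
  qed
  have "\<phi> p \<le> m"
  proof (rule field_le_epsilon)
    fix e :: real assume "e > 0"
    then have "a * (hr p - e / a) + 1/2 * (norm (p - z))\<^sup>2 \<le> m"
      using a hr[OF pd] by (intro key) simp
    then show "\<phi> p \<le> m + e" using a by (simp add: \<phi>_def algebra_simps)
  qed
  have "ereal (\<phi> p) \<le> ereal a * h w + ereal (1/2 * (norm (w - z))\<^sup>2)" for w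
  proof (cases "w \<in> edom h")
    case True
    then show ?thesis using m[OF True] \<open>\<phi> p \<le> m\<close> by (simp only: \<phi>) simp
  next
    case False
    then show ?thesis using a by (simp add: edom_def)
  qed
  then show ?thesis using pd \<phi>[OF pd] by (intro exI[of _ p]) (simp add: minimizers_def)
qed

lemma le_of_le_add_scaled:
  fixes A B C :: real
  assumes "\<And>t. 0 < t \<Longrightarrow> t < 1 \<Longrightarrow> A \<le> B + t * C"
  shows "A \<le> B"
proof (rule tendsto_lowerbound)
  show "((\<lambda>t. B + t * C) \<longlongrightarrow> B) (at_right 0)"
    by (auto intro!: tendsto_eq_intros)
  show "eventually (\<lambda>t. A \<le> B + t * C) (at_right 0)"
    unfolding eventually_at_right_field by (rule exI[of _ 1]) (use assms in auto)
qed simp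

text \<open>The variational inequality, saying in effect that \<open>(z - p) / a\<close> is a
  subgradient of \<open>h\<close> at \<open>p\<close>. Compare \<open>p\<close> with the points of
  the segment towards \<open>y\<close>, divide by \<open>t\<close> and let \<open>t\<close> tend to
  0.\<close>

lemma prox_objective_minimizer_ineq:
  fixes h :: "'a::real_inner \<Rightarrow> ereal"
  assumes h: "econvex h" and a: "a > 0"
    and p: "p \<in> minimizers (\<lambda>w. ereal a * h w + ereal (1/2 * (norm (w - z))\<^sup>2))"
    and hp: "h p = ereal hp" and hy: "h y = ereal hy"
  shows "a * hp + (z - p) \<bullet> (y - p) \<le> a * hy"
proof -
  have "a * hp + (z - p) \<bullet> (y - p) \<le> a * hy + t * (1/2 * (norm (y - p))\<^sup>2)" if t: "0 < t" "t < 1" for t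
  proof -
    let ?q = "(1 - t) *\<^sub>R p + t *\<^sub>R y"
    have hq: "h ?q \<le> ereal ((1 - t) * hp + t * hy)"
      using h t hp hy by (intro econvex_ereal_bound)
    have "ereal (a * hp + 1/2 * (norm (p - z))\<^sup>2) \<le> ereal a * h ?q + ereal (1/2 * (norm (?q - z))\<^sup>2)"
      using p by (auto simp: minimizers_def hp dest: spec[of _ ?q])
    also have "\<dots> \<le> ereal a * ereal ((1 - t) * hp + t * hy) + ereal (1/2 * (norm (?q - z))\<^sup>2)"
      using a hq by (intro add_right_mono ereal_mult_left_mono) auto
    finally have le: "a * hp + 1/2 * (norm (p - z))\<^sup>2
      \<le> a * ((1 - t) * hp + t * hy) + 1/2 * (norm (?q - z))\<^sup>2" by simp
    have "?q - z = (p - z) + t *\<^sub>R (y - p)" by (simp add: algebra_simps)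
    then have "(norm (?q - z))\<^sup>2
        = (norm (p - z))\<^sup>2 + 2 * t * ((p - z) \<bullet> (y - p)) + t\<^sup>2 * (norm (y - p))\<^sup>2"
      unfolding power2_norm_eq_inner
      by (simp add: inner_add_left inner_add_right inner_commute power2_eq_square algebra_simps)
    with le have "0 \<le> t * (a * hy - a * hp + (p - z) \<bullet> (y - p) + t * (1/2 * (norm (y - p))\<^sup>2))"
      by (simp add: algebra_simps power2_eq_square)
    then have "0 \<le> a * hy - a * hp + (p - z) \<bullet> (y - p) + t * (1/2 * (norm (y - p))\<^sup>2)"
      using t by (simp add: zero_le_mult_iff)
    moreover have "(z - p) \<bullet> (y - p) = - ((p - z) \<bullet> (y - p))"
      by (simp add: inner_diff_left)
    ultimately show ?thesis by simp
  qed
  then show ?thesis by (rule le_of_le_add_scaled)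
qed

text \<open>\<open>prox\<close> is a definite description, so existence must be joined by
  uniqueness: adding the variational inequalities of two minimizers gives
  \<open>(q - p) \<bullet> (q - p) \<le> 0\<close>.\<close>

theorem prox_in_edom_and_ineq:
  fixes h :: "'a::{real_inner, complete_space} \<Rightarrow> ereal"
  assumes h: "proper h" "lsc h" "econvex h" and a: "a > 0"
    and minorant: "R \<ge> 0" "\<And>y. ereal (c - R * norm y) \<le> h y"
  shows prox_in_edom: "prox a h z \<in> edom h"
    and prox_ineq: "\<And>hp hy y. h (prox a h z) = ereal hp \<Longrightarrow> h y = ereal hy \<Longrightarrow>
      a * hp + (z - prox a h z) \<bullet> (y - prox a h z) \<le> a * hy"
proof -
  let ?M = "minimizers (\<lambda>w. ereal a * h w + ereal (1/2 * (norm (w - z))\<^sup>2))"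
  obtain p where p: "p \<in> edom h" "p \<in> ?M"
    using prox_objective_has_minimizer[OF assms] by blast
  have fin: "\<exists>r. h y = ereal r" if "y \<in> edom h" for y
    using h(1) that by (cases "h y") (auto simp: proper_def edom_def)
  have unique: "q = p" if q: "q \<in> ?M" for q
  proof -
    have "ereal a * h q + ereal (1/2 * (norm (q - z))\<^sup>2) \<le> ereal a * h p + ereal (1/2 * (norm (p - z))\<^sup>2)"
      using q by (simp add: minimizers_def)
    then have "q \<in> edom h" using fin[OF p(1)] a by (cases "h q") (auto simp: edom_def)
    then obtain r s where rs: "h p = ereal r" "h q = ereal s" using fin p by blast
    have "a * r + (z - p) \<bullet> (q - p) \<le> a * s" "a * s + (z - q) \<bullet> (p - q) \<le> a * r"
      using prox_objective_minimizer_ineq[OF h(3) a] p(2) q rs by blast+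
    moreover have "(z - p) \<bullet> (q - p) + (z - q) \<bullet> (p - q) = (q - p) \<bullet> (q - p)"
      by (simp add: inner_diff_left inner_diff_right algebra_simps)
    ultimately have "(q - p) \<bullet> (q - p) \<le> 0" by linarith
    then show ?thesis using inner_ge_zero[of "q - p"] inner_eq_zero_iff[of "q - p"] by auto
  qed
  have eq: "prox a h z = p" unfolding prox_def by (rule the_equality) (rule p(2), rule unique)
  show "prox a h z \<in> edom h" unfolding eq by (rule p(1))
  show "a * hp + (z - prox a h z) \<bullet> (y - prox a h z) \<le> a * hy"
    if "h (prox a h z) = ereal hp" "h y = ereal hy" for hp hy y
    using that unfolding eq by (rule prox_objective_minimizer_ineq[OF h(3) a p(2)])
qed

section \<open>Weak limits along filters\<close>

text \<open>The representer of \<open>\<phi>\<close> is minus the proximal point of \<open>\<phi>\<close> at the origin.\<close>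

lemma Riesz_representation:
  fixes \<phi> :: "'a::{real_inner, complete_space} \<Rightarrow> real"
  assumes "bounded_linear \<phi>"
  shows "\<exists>p. \<forall>w. \<phi> w = p \<bullet> w"
proof -
  interpret bounded_linear \<phi> by fact
  define h where "h w = ereal (\<phi> w)" for w
  define p where "p = prox 1 h 0"
  obtain R where R: "R \<ge> 0" "\<And>w. \<bar>\<phi> w\<bar> \<le> norm w * R"
    using nonneg_bounded by (auto simp: real_norm_def)
  have "proper h" by (auto simp: proper_def h_def edom_def)
  moreover have "lsc h"
    unfolding lsc_def
  proof
    fix w
    have "isCont \<phi> w" by (intro isCont) auto
    then have "(h \<longlongrightarrow> h w) (nhds w)"
      unfolding h_def by (simp add: continuous_at tendsto_at_iff_tendsto_nhds)
    then show "h w \<le> Liminf (nhds w) h" by (simp add: lim_imp_Liminf)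
  qed
  moreover have "econvex h" by (simp add: econvex_def h_def add scaleR)
  moreover have "ereal (0 - R * norm w) \<le> h w" for w
    using R(2)[of w] by (simp add: h_def abs_le_iff mult.commute)
  ultimately have ineq: "\<phi> p + (0 - p) \<bullet> (y - p) \<le> \<phi> y" for y
    using prox_ineq[of h 1 R 0 0 "\<phi> p" y "\<phi> y"] R(1) by (simp add: p_def h_def)
  \<comment> \<open>Testing with \<open>p + d\<close> cancels \<open>\<phi> p\<close> by linearity;
    using both \<open>d\<close> and \<open>- d\<close> then turns the inequality into an
    equality.\<close>
  have le: "- (p \<bullet> d) \<le> \<phi> d" for d
    using ineq[of "p + d"] by (simp add: add)
  have "\<phi> d = (- p) \<bullet> d" for d
    using le[of d] le[of "- d"] by (simp add: neg)
  then show ?thesis by blast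
qed

text \<open>Mazur's theorem for filters. With \<open>q\<close> the projection of \<open>p\<close>
  onto \<open>C\<close>, the obtuse-angle inequality at the points \<open>x k\<close> passes to the
  weak limit and gives \<open>(p - q) \<bullet> (p - q) \<le> 0\<close>.\<close>

lemma weak_limit_in_closed_convex:
  fixes x :: "'b \<Rightarrow> 'a::{real_inner, complete_space}"
  assumes C: "closed C" "convex C"
    and G: "G \<noteq> bot" "eventually (\<lambda>k. x k \<in> C) G" "\<And>w. ((\<lambda>k. x k \<bullet> w) \<longlongrightarrow> p \<bullet> w) G"
  shows "p \<in> C"
proof -
  define h :: "'a \<Rightarrow> ereal" where "h y = (if y \<in> C then 0 else \<infinity>)" for y
  define q where "q = prox 1 h p"
  have "C \<noteq> {}" using G(1,2) eventually_happens' by fastforce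
  then have h: "proper h" by (auto simp: proper_def h_def edom_def)
  have "lsc h" unfolding h_def using C(1) by (rule lsc_indicator_closed)
  moreover have "econvex h"
    unfolding econvex_def
  proof (intro allI impI)
    fix y z and t :: real
    assume t: "0 < t" "t < 1"
    show "h ((1 - t) *\<^sub>R y + t *\<^sub>R z) \<le> ereal (1 - t) * h y + ereal t * h z"
    proof (cases "y \<in> C \<and> z \<in> C")
      case True
      then have "(1 - t) *\<^sub>R y + t *\<^sub>R z \<in> C" using C(2) t by (auto simp: convex_alt)
      then show ?thesis using True by (simp add: h_def)
    next
      case False
      then show ?thesis using t by (auto simp: h_def)
    qed
  qed
  moreover have "ereal (0 - 0 * norm y) \<le> h y" for y by (simp add: h_def)
  ultimately have prox: "q \<in> edom h"
    "\<And>hp hy y. h q = ereal hp \<Longrightarrow> h y = ereal hy \<Longrightarrow> 1 * hp + (p - q) \<bullet> (y - q) \<le> 1 * hy"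
    unfolding q_def by (rule prox_in_edom_and_ineq[OF h _ _ zero_less_one order_refl])+
  have qC: "q \<in> C" using prox(1) by (auto simp: edom_def h_def split: if_splits)
  have ineq: "(p - q) \<bullet> (y - q) \<le> 0" if "y \<in> C" for y
    using prox(2)[of 0 y 0] that qC by (simp add: h_def zero_ereal_def)
  have "((\<lambda>k. x k \<bullet> (p - q) - q \<bullet> (p - q)) \<longlongrightarrow> p \<bullet> (p - q) - q \<bullet> (p - q)) G"
    by (intro tendsto_intros G)
  then have "((\<lambda>k. (p - q) \<bullet> (x k - q)) \<longlongrightarrow> (p - q) \<bullet> (p - q)) G"
    by (simp add: inner_diff_right inner_commute algebra_simps)
  moreover have "eventually (\<lambda>k. (p - q) \<bullet> (x k - q) \<le> 0) G"
    using G(2) by eventually_elim (rule ineq)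
  ultimately have "(p - q) \<bullet> (p - q) \<le> 0" using G(1) by (rule tendsto_upperbound)
  then have "p = q" using inner_ge_zero[of "p - q"] inner_eq_zero_iff[of "p - q"] by auto
  then show ?thesis using qC by simp
qed

text \<open>
  Weak compactness of balls, phrased with filters so that Tychonoff's theorem for
  \<^typ>\<open>'a \<Rightarrow> real\<close> applies without any separability argument.
\<close>

lemma bounded_imp_weak_limit_along_filter:
  fixes x :: "'b \<Rightarrow> 'a::{real_inner, complete_space}"
  assumes G: "G \<noteq> bot" and R: "\<And>k. norm (x k) \<le> R"
  shows "\<exists>p G'. G' \<le> G \<and> G' \<noteq> bot \<and> (\<forall>w. ((\<lambda>k. x k \<bullet> w) \<longlongrightarrow> p \<bullet> w) G')"
proof -
  define \<Phi> where "\<Phi> k = (\<lambda>w. x k \<bullet> w)" for k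
  \<comment> \<open>Cauchy-Schwarz puts every functional \<open>\<Phi> k\<close> into this product
    of compact intervals.\<close>
  define K where "K = (\<Pi>\<^sub>E w\<in>(UNIV::'a set). {- (R * norm w)..R * norm w})"
  have "compactin (product_topology (\<lambda>w. euclidean) UNIV) K"
    unfolding K_def compactin_PiE by auto
  then have "compact K" by (simp add: euclidean_product_topology)
  moreover have "filtermap \<Phi> G \<noteq> bot" using G by (simp add: filtermap_bot_iff)
  moreover have inK: "\<Phi> k \<in> K" for k
  proof -
    have "\<bar>x k \<bullet> w\<bar> \<le> R * norm w" for w
      using Cauchy_Schwarz_ineq2[of "x k" w] mult_right_mono[OF R norm_ge_zero, of k w] by linarith
    then show ?thesis by (auto simp: K_def \<Phi>_def abs_le_iff) (smt (verit))
  qed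
  ultimately obtain \<phi> where \<phi>: "\<phi> \<in> K" "inf (nhds \<phi>) (filtermap \<Phi> G) \<noteq> bot"
    unfolding compact_filter by (force simp: eventually_filtermap)
  \<comment> \<open>Refining \<open>G\<close> by the preimages of neighbourhoods of the cluster
    point \<open>\<phi>\<close> makes \<open>\<Phi>\<close> converge to it.\<close>
  define G' where "G' = inf G (filtercomap \<Phi> (nhds \<phi>))"
  have "G' \<le> G" by (simp add: G'_def)
  have "G' \<noteq> bot"
  proof
    assume "G' = bot"
    then have "eventually (\<lambda>_. False) G'" by simp
    then obtain P Q where PQ: "eventually P G" "eventually Q (nhds \<phi>)" "\<And>k. P k \<Longrightarrow> Q (\<Phi> k) \<Longrightarrow> False"
      unfolding G'_def eventually_inf eventually_filtercomap by metis
    have "eventually (\<lambda>y. \<not> Q y) (filtermap \<Phi> G)"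
      unfolding eventually_filtermap using PQ(1) by (rule eventually_mono) (use PQ(3) in blast)
    with PQ(2) have "eventually (\<lambda>_. False) (inf (nhds \<phi>) (filtermap \<Phi> G))"
      unfolding eventually_inf by blast
    with \<phi>(2) show False by (simp add: trivial_limit_def)
  qed
  have "(\<Phi> \<longlongrightarrow> \<phi>) G'"
    unfolding G'_def by (rule filterlim_mono[OF filterlim_filtercomap order_refl]) simp
  then have lim: "((\<lambda>k. x k \<bullet> w) \<longlongrightarrow> \<phi> w) G'" for w
    using continuous_on_tendsto_compose[OF continuous_on_product_coordinates[of w], of \<Phi> \<phi> G']
    by (simp add: \<Phi>_def)
  \<comment> \<open>Linearity passes to pointwise limits, and membership in \<open>K\<close> bounds
    \<open>\<phi>\<close>.\<close>
  have "bounded_linear \<phi>"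
  proof (rule bounded_linear_intro[where K = R])
    fix v w :: 'a and r :: real
    have "((\<lambda>k. x k \<bullet> (v + w)) \<longlongrightarrow> \<phi> v + \<phi> w) G'"
      unfolding inner_add_right by (intro tendsto_add lim)
    then show "\<phi> (v + w) = \<phi> v + \<phi> w" using lim \<open>G' \<noteq> bot\<close> tendsto_unique by blast
    have "((\<lambda>k. x k \<bullet> (r *\<^sub>R w)) \<longlongrightarrow> r * \<phi> w) G'"
      unfolding inner_scaleR_right by (intro tendsto_mult tendsto_const lim)
    then show "\<phi> (r *\<^sub>R w) = r *\<^sub>R \<phi> w" using lim \<open>G' \<noteq> bot\<close> tendsto_unique by (metis real_scaleR_def)
    show "norm (\<phi> w) \<le> norm w * R"
      using \<phi>(1) by (auto simp: K_def PiE_iff abs_le_iff mult.commute) (smt (verit))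
  qed
  then obtain p where "\<And>w. \<phi> w = p \<bullet> w" using Riesz_representation by metis
  then show ?thesis using lim \<open>G' \<le> G\<close> \<open>G' \<noteq> bot\<close> by auto
qed

text \<open>Opial's argument. The difference of the squared distances to two weak cluster points
  \<open>p\<close> and \<open>q\<close> is affine in \<open>x k\<close> and converges; computing its
  limit along both filters forces \<open>p = q\<close>.\<close>

lemma Opial_weak_convergence:
  fixes x :: "nat \<Rightarrow> 'a::{real_inner, complete_space}"
  assumes bnd: "bounded (range x)"
    and S: "\<And>p G. G \<le> sequentially \<Longrightarrow> G \<noteq> bot \<Longrightarrow> (\<And>w. ((\<lambda>k. x k \<bullet> w) \<longlongrightarrow> p \<bullet> w) G) \<Longrightarrow> p \<in> S"
    and conv: "\<And>s. s \<in> S \<Longrightarrow> convergent (\<lambda>k. (norm (x k - s))\<^sup>2)"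
  shows "\<exists>p\<in>S. weakly_converges x p"
proof -
  obtain R where R: "\<And>k. norm (x k) \<le> R" using bnd by (auto simp: bounded_iff)
  obtain p G where G: "G \<le> sequentially" "G \<noteq> bot" "\<And>w. ((\<lambda>k. x k \<bullet> w) \<longlongrightarrow> p \<bullet> w) G"
    using bounded_imp_weak_limit_along_filter[OF sequentially_bot, of x R] R by blast
  have p: "p \<in> S" using S G by blast
  have "weakly_converges x p"
    unfolding weakly_converges_def
  proof (rule ccontr)
    assume "\<not> (\<forall>w. (\<lambda>k. x k \<bullet> w) \<longlonglongrightarrow> p \<bullet> w)"
    then obtain w e where e: "e > 0" "\<not> eventually (\<lambda>k. dist (x k \<bullet> w) (p \<bullet> w) < e) sequentially"
      by (auto simp: tendsto_iff)
    \<comment> \<open>\<open>H\<close> keeps the indices that violate weak convergence by at least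
      \<open>e\<close>; a weak cluster point along it must be \<open>p\<close>, which is
      contradictory.\<close>
    define H where "H = inf sequentially (principal {k. \<not> dist (x k \<bullet> w) (p \<bullet> w) < e})"
    have "H \<noteq> bot"
      using e(2) by (auto simp: H_def trivial_limit_def eventually_inf_principal)
    then obtain q H' where H': "H' \<le> H" "H' \<noteq> bot" "\<And>v. ((\<lambda>k. x k \<bullet> v) \<longlongrightarrow> q \<bullet> v) H'"
      using bounded_imp_weak_limit_along_filter[of H x R] R by blast
    have H's: "H' \<le> sequentially" using H'(1) by (simp add: H_def)
    have q: "q \<in> S" using S H's H' by blast
    have "convergent (\<lambda>k. (norm (x k - q))\<^sup>2 - (norm (x k - p))\<^sup>2)"
      using conv p q by (intro convergent_diff)
    then obtain L where L: "(\<lambda>k. (norm (x k - q))\<^sup>2 - (norm (x k - p))\<^sup>2) \<longlonglongrightarrow> L"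
      by (auto simp: convergent_def)
    have "(norm (x k - q))\<^sup>2 - (norm (x k - p))\<^sup>2 = 2 * (x k \<bullet> (p - q)) + (q \<bullet> q - p \<bullet> p)" for k
      unfolding power2_norm_eq_inner
      by (simp add: inner_diff_left inner_diff_right inner_commute algebra_simps)
    with L have L: "(\<lambda>k. 2 * (x k \<bullet> (p - q)) + (q \<bullet> q - p \<bullet> p)) \<longlonglongrightarrow> L" by simp
    have "((\<lambda>k. 2 * (x k \<bullet> (p - q)) + (q \<bullet> q - p \<bullet> p)) \<longlongrightarrow> 2 * (p \<bullet> (p - q)) + (q \<bullet> q - p \<bullet> p)) G"
      by (intro tendsto_intros G)
    then have L1: "L = 2 * (p \<bullet> (p - q)) + (q \<bullet> q - p \<bullet> p)"
      using tendsto_mono[OF G(1) L] G(2) tendsto_unique by blast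
    have "((\<lambda>k. 2 * (x k \<bullet> (p - q)) + (q \<bullet> q - p \<bullet> p)) \<longlongrightarrow> 2 * (q \<bullet> (p - q)) + (q \<bullet> q - p \<bullet> p)) H'"
      by (intro tendsto_intros H')
    then have L2: "L = 2 * (q \<bullet> (p - q)) + (q \<bullet> q - p \<bullet> p)"
      using tendsto_mono[OF H's L] H'(2) tendsto_unique by blast
    have "(p - q) \<bullet> (p - q) = 0" using L1 L2 by (simp add: inner_diff_left)
    then have "p = q" by simp
    then have "eventually (\<lambda>k. dist (x k \<bullet> w) (p \<bullet> w) < e) H'"
      using H'(3)[of w] e(1) by (auto simp: tendsto_iff)
    moreover have "eventually (\<lambda>k. \<not> dist (x k \<bullet> w) (p \<bullet> w) < e) H"
      by (simp add: H_def eventually_inf_principal)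
    ultimately have "eventually (\<lambda>_. False) H'"
      using filter_leD[OF H'(1)] eventually_elim2 by blast
    with H'(2) show False by (simp add: trivial_limit_def)
  qed
  with p show ?thesis by blast
qed

section \<open>Quasi-decreasing real sequences\<close>

text \<open>Subtracting the partial sums of \<open>b\<close> leaves a decreasing sequence that is
  bounded below.\<close>

lemma quasi_decreasing_convergent:
  fixes a b :: "nat \<Rightarrow> real"
  assumes a: "\<And>n. 0 \<le> a n" and le: "\<And>n. a (Suc n) \<le> a n + b n" and b: "summable b"
  shows "convergent a"
proof -
  define c where "c n = a n - (\<Sum>i<n. b i)" for n
  have "decseq c" unfolding decseq_Suc_iff c_def using le by (simp add: algebra_simps)
  obtain B where B: "\<And>n. norm (\<Sum>i<n. b i) \<le> B"
    using convergent_imp_Bseq[of "\<lambda>n. \<Sum>i<n. b i"] b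
    by (auto simp: summable_iff_convergent Bseq_def)
  have "- B \<le> c n" for n using a[of n] B[of n] by (simp add: c_def)
  then obtain L where "c \<longlonglongrightarrow> L" using \<open>decseq c\<close> decseq_convergent[of c "- B"] by blast
  then have "(\<lambda>n. c n + (\<Sum>i<n. b i)) \<longlonglongrightarrow> L + suminf b"
    using b by (intro tendsto_add summable_LIMSEQ)
  then show ?thesis by (auto simp: c_def convergent_def)
qed

text \<open>Telescoping bounds the partial sums of \<open>c\<close>.\<close>

lemma quasi_decreasing_summable:
  fixes a b c :: "nat \<Rightarrow> real"
  assumes a: "\<And>n. 0 \<le> a n" and c: "\<And>n. 0 \<le> c n" and b: "summable b"
    and le: "\<And>n. a (Suc n) + c n \<le> a n + b n"
  shows "summable c"
proof -
  obtain B where B: "\<And>n. norm (\<Sum>i<n. b i) \<le> B"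
    using convergent_imp_Bseq[of "\<lambda>n. \<Sum>i<n. b i"] b
    by (auto simp: summable_iff_convergent Bseq_def)
  have tel: "a n + (\<Sum>i<n. c i) \<le> a 0 + (\<Sum>i<n. b i)" for n
  proof (induction n)
    case (Suc n)
    then show ?case using le[of n] by simp
  qed simp
  have "(\<Sum>i<n. c i) \<le> a 0 + B" for n
    using tel[of n] a[of n] B[of n] by simp
  then show ?thesis using c by (intro summableI_nonneg_bounded)
qed

text \<open>A positive limit would make \<open>w\<close> eventually dominated by a multiple of the
  summable \<open>w n * d n\<close>.\<close>

lemma limit_zero_if_weighted_summable:
  fixes w d :: "nat \<Rightarrow> real"
  assumes w: "\<And>n. 0 < w n" "\<not> summable w" and d: "\<And>n. 0 \<le> d n" "d \<longlonglongrightarrow> L"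
    and sum: "summable (\<lambda>n. w n * d n)"
  shows "L = 0"
proof (rule ccontr)
  assume "L \<noteq> 0"
  moreover have "0 \<le> L" using d by (auto intro: LIMSEQ_le_const)
  ultimately have "L > 0" by simp
  then have "eventually (\<lambda>n. d n > L / 2) sequentially"
    using d(2) by (intro order_tendstoD) auto
  then have "eventually (\<lambda>n. norm (w n) \<le> 2 / L * (w n * d n)) sequentially"
  proof eventually_elim
    case (elim n)
    then have "w n * (L / 2) \<le> w n * d n" using w(1)[of n] by simp
    then show ?case using \<open>L > 0\<close> w(1)[of n] by (simp add: field_simps)
  qed
  then have "summable w"
    using summable_mult[OF sum] by (rule summable_comparison_test_ev)
  with w(2) show False by simp
qed

section \<open>The proximal subgradient splitting method\<close>

text \<open>\<open>\<rho>\<close> is a fixed witness for A2, and divergence of the series is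
  expressed as non-summability.\<close>

locale pss_method =
  fixes f g :: "'a::{real_inner, complete_space} \<Rightarrow> ereal"
    and x u :: "nat \<Rightarrow> 'a"
    and \<alpha> \<beta> :: "nat \<Rightarrow> real"
    and \<rho> :: real
  assumes f: "proper f" "lsc f" "econvex f"
    and g: "proper g" "lsc g" "econvex g"
    and dom: "edom g \<subseteq> edom f"
    and subdiff_f_bounded: "\<And>V. V \<subseteq> edom g \<Longrightarrow> bounded V \<Longrightarrow> closed V \<Longrightarrow>
               \<exists>\<zeta>>0. \<forall>z\<in>V. subdifferential f z \<subseteq> cball 0 \<zeta>"
    and rho_nonneg: "\<rho> \<ge> 0"
    and subdiff_g: "\<And>z. z \<in> edom g \<Longrightarrow> subdifferential g z \<inter> cball 0 \<rho> \<noteq> {}"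
    and pss: "pss_sequence f g \<alpha> u x"
    and stepsize: "\<And>k. \<alpha> k = \<beta> k / max 1 (norm (u k))"
    and beta_pos: "\<And>k. \<beta> k > 0"
    and beta_sq: "summable (\<lambda>k. (\<beta> k)\<^sup>2)"
    and beta_not_summable: "\<not> summable \<beta>"
begin

section \<open>Finite values on the domain and consequences of A2\<close>

abbreviation F :: "'a \<Rightarrow> ereal" where "F z \<equiv> f z + g z"

text \<open>Agrees with \<open>F\<close> only on \<open>edom g\<close>, since
  \<open>real_of_ereal\<close> sends \<open>\<infinity>\<close> to 0.\<close>

definition Fr :: "'a \<Rightarrow> real" where "Fr z = real_of_ereal (f z) + real_of_ereal (g z)"

lemma finite_on_dom:
  assumes "z \<in> edom g"
  shows "f z = ereal (real_of_ereal (f z))" "g z = ereal (real_of_ereal (g z))"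
proof -
  have "z \<in> edom f" using assms dom by auto
  then show "f z = ereal (real_of_ereal (f z))" "g z = ereal (real_of_ereal (g z))"
    using assms f(1) g(1) by (cases "f z"; cases "g z"; auto simp: edom_def proper_def)+
qed

lemma F_eq_Fr: "z \<in> edom g \<Longrightarrow> F z = ereal (Fr z)"
  using finite_on_dom[of z] unfolding Fr_def by (metis plus_ereal.simps(1))

lemma F_finite_imp_dom: "F z < \<infinity> \<Longrightarrow> z \<in> edom g"
  using f(1) by (cases "g z") (auto simp: edom_def proper_def)

text \<open>A subgradient at \<open>z\<close> of norm at most \<open>\<rho>\<close> gives one half
  of the Lipschitz estimate; exchanging the points gives the other.\<close>

lemma g_lipschitz:
  assumes "y \<in> edom g" "z \<in> edom g"
  shows "real_of_ereal (g z) - \<rho> * norm (y - z) \<le> real_of_ereal (g y)"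
proof -
  obtain v where v: "v \<in> subdifferential g z" "norm v \<le> \<rho>" using subdiff_g[OF assms(2)] by auto
  have "\<bar>v \<bullet> (y - z)\<bar> \<le> \<rho> * norm (y - z)"
    using Cauchy_Schwarz_ineq2[of v "y - z"] mult_right_mono[OF v(2) norm_ge_zero, of "y - z"]
    by linarith
  then show ?thesis
    using subgradient_ineq[OF v(1) finite_on_dom(2)[OF assms(2)] finite_on_dom(2)[OF assms(1)]]
    by linarith
qed

text \<open>This is the lower bound under which the proximal points of \<open>g\<close>
  exist.\<close>

lemma g_minorant: "\<exists>c. \<forall>y. ereal (c - \<rho> * norm y) \<le> g y"
proof -
  obtain z where z: "z \<in> edom g" using g(1) by (auto simp: proper_def)
  have "ereal (real_of_ereal (g z) - \<rho> * norm z - \<rho> * norm y) \<le> g y" for y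
  proof (cases "y \<in> edom g")
    case True
    have "\<rho> * norm (y - z) \<le> \<rho> * (norm y + norm z)"
      using rho_nonneg by (intro mult_left_mono norm_triangle_ineq4)
    then have "real_of_ereal (g z) - \<rho> * norm z - \<rho> * norm y \<le> real_of_ereal (g y)"
      using g_lipschitz[OF True z] by (simp add: distrib_left)
    then show ?thesis using finite_on_dom(2)[OF True] by (metis ereal_less_eq(3))
  qed (simp add: edom_def)
  then show ?thesis by blast
qed

text \<open>Needed since A1 concerns closed sets only. Along a convergent sequence the Lipschitz
  estimate bounds \<open>g\<close>, and lower semicontinuity carries the bound to the limit.\<close>

lemma closed_dom: "closed (edom g)"
  unfolding closed_sequential_limits
proof safe
  fix X p assume X: "\<forall>n. X n \<in> edom g" "X \<longlonglongrightarrow> p"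
  obtain K where K: "\<And>n. norm (X n) \<le> K"
    using convergent_imp_Bseq[of X] X(2) by (auto simp: convergent_def Bseq_def)
  have "g (X n) \<le> ereal (real_of_ereal (g (X 0)) + \<rho> * (K + K))" for n
  proof -
    have "norm (X 0 - X n) \<le> K + K"
      using norm_triangle_ineq4[of "X 0" "X n"] K[of 0] K[of n] by linarith
    then have "\<rho> * norm (X 0 - X n) \<le> \<rho> * (K + K)"
      using rho_nonneg by (rule mult_left_mono)
    then have "real_of_ereal (g (X n)) \<le> real_of_ereal (g (X 0)) + \<rho> * (K + K)"
      using g_lipschitz[of "X 0" "X n"] X(1) by force
    then show ?thesis using finite_on_dom(2)[of "X n"] X(1) by (metis ereal_less_eq(3))
  qed
  then have "liminf (\<lambda>n. g (X n)) \<le> liminf (\<lambda>n::nat. ereal (real_of_ereal (g (X 0)) + \<rho> * (K + K)))"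
    by (intro Liminf_mono always_eventually) simp
  then have "g p \<le> ereal (real_of_ereal (g (X 0)) + \<rho> * (K + K))"
    using lsc_le_liminf[OF g(2) X(2)] by (simp add: Liminf_const)
  then show "p \<in> edom g" by (auto simp: edom_def intro: order_le_less_trans)
qed

section \<open>One step of the method\<close>

lemma step:
  shows alpha_pos: "\<alpha> k > 0"
    and u_subdiff: "u k \<in> subdifferential f (x k)"
    and x_Suc: "x (Suc k) = prox (\<alpha> k) g (x k - \<alpha> k *\<^sub>R u k)"
  using pss by (auto simp: pss_sequence_def)

lemma beta_eq: "\<beta> k = max 1 (norm (u k)) * \<alpha> k"
proof -
  have "0 < max 1 (norm (u k))" by (simp add: less_max_iff_disj)
  then show ?thesis by (simp add: stepsize)
qed

lemma x_in_dom: "x k \<in> edom g"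
proof (cases k)
  case 0
  then show ?thesis using pss by (simp add: pss_sequence_def)
next
  case (Suc n)
  obtain c where "\<And>y. ereal (c - \<rho> * norm y) \<le> g y" using g_minorant by blast
  then show ?thesis unfolding Suc x_Suc using g alpha_pos rho_nonneg by (intro prox_in_edom)
qed

lemma x_Suc_ineq:
  assumes "z \<in> edom g"
  shows "\<alpha> k * real_of_ereal (g (x (Suc k))) + (x k - \<alpha> k *\<^sub>R u k - x (Suc k)) \<bullet> (z - x (Suc k))
    \<le> \<alpha> k * real_of_ereal (g z)"
proof -
  obtain c where c: "\<And>y. ereal (c - \<rho> * norm y) \<le> g y" using g_minorant by blast
  show ?thesis
    using prox_ineq[OF g alpha_pos rho_nonneg c, of k "x k - \<alpha> k *\<^sub>R u k"]
      finite_on_dom(2)[OF x_in_dom, of "Suc k"] finite_on_dom(2)[OF assms]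
    unfolding x_Suc[symmetric] by blast
qed

text \<open>
  Normalising the step by \<open>max 1 (norm (u k))\<close> keeps the error term proportional to
  \<open>(\<beta> k)\<^sup>2\<close> without any a priori bound on the subgradients.
\<close>

lemma fejer_ineq:
  assumes z: "z \<in> edom g"
  shows "(norm (x (Suc k) - z))\<^sup>2
    \<le> (norm (x k - z))\<^sup>2 + 2 * \<alpha> k * (Fr z - Fr (x k)) + ((1 + \<rho>) * \<beta> k)\<^sup>2"
proof -
  \<comment> \<open>This subgradient moves \<open>g\<close> from the new iterate back to
    \<open>x k\<close>, so that \<open>f\<close> and \<open>g\<close> are finally evaluated at the
    same point.\<close>
  obtain w where w: "w \<in> subdifferential g (x k)" "norm w \<le> \<rho>"
    using subdiff_g[OF x_in_dom[of k]] by auto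
  let ?a = "\<alpha> k" and ?y = "x (Suc k)"
  have "real_of_ereal (f (x k)) + u k \<bullet> (z - x k) \<le> real_of_ereal (f z)"
    using u_subdiff finite_on_dom(1)[OF x_in_dom] finite_on_dom(1)[OF z] by (rule subgradient_ineq)
  then have 1: "?a * (u k \<bullet> (z - x k)) \<le> ?a * (real_of_ereal (f z) - real_of_ereal (f (x k)))"
    using alpha_pos[of k] by (intro mult_left_mono) auto
  have "real_of_ereal (g (x k)) + w \<bullet> (?y - x k) \<le> real_of_ereal (g ?y)"
    using w(1) finite_on_dom(2)[OF x_in_dom] finite_on_dom(2)[OF x_in_dom] by (rule subgradient_ineq)
  then have 2: "?a * (w \<bullet> (?y - x k)) \<le> ?a * (real_of_ereal (g ?y) - real_of_ereal (g (x k)))"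
    using alpha_pos[of k] by (intro mult_left_mono) auto
  note 3 = x_Suc_ineq[OF z, of k]
  \<comment> \<open>The square trades the cross term \<open>u k \<bullet> (x k - ?y)\<close> for
    harmless ones: the squared step length cancels in 5, and the \<open>w\<close> term is bounded by
    2.\<close>
  have "0 \<le> (norm (?a *\<^sub>R (u k + w) - (x k - ?y)))\<^sup>2" by simp
  also have "\<dots> = (norm (?a *\<^sub>R (u k + w)))\<^sup>2 - 2 * (?a * (u k \<bullet> (x k - ?y)))
      + 2 * (?a * (w \<bullet> (?y - x k))) + (norm (x k - ?y))\<^sup>2"
    unfolding power2_norm_eq_inner
    by (simp add: inner_diff_left inner_diff_right inner_add_left inner_add_right inner_commute
        algebra_simps)
  finally have 4: "2 * (?a * (u k \<bullet> (x k - ?y))) \<le> (norm (?a *\<^sub>R (u k + w)))\<^sup>2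
      + 2 * (?a * (w \<bullet> (?y - x k))) + (norm (x k - ?y))\<^sup>2" by linarith
  have 5: "(norm (?y - z))\<^sup>2 = (norm (x k - z))\<^sup>2 - (norm (x k - ?y))\<^sup>2
      + 2 * ((x k - ?a *\<^sub>R u k - ?y) \<bullet> (z - ?y))
      + 2 * (?a * (u k \<bullet> (z - x k))) + 2 * (?a * (u k \<bullet> (x k - ?y)))"
    unfolding power2_norm_eq_inner
    by (simp add: inner_diff_left inner_diff_right inner_commute algebra_simps)
  \<comment> \<open>The factor \<open>max 1 (norm (u k))\<close> dominates \<open>norm (u k)\<close>
    and, being at least 1, lets \<open>\<rho>\<close> be multiplied by it too.\<close>
  have "norm (u k + w) \<le> norm (u k) + \<rho>"
    using norm_triangle_ineq[of "u k" w] w(2) by linarith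
  also have "\<dots> \<le> max 1 (norm (u k)) * (1 + \<rho>)"
    using mult_right_mono[of 1 "max 1 (norm (u k))" \<rho>] rho_nonneg by (simp add: distrib_left)
  finally have "?a * norm (u k + w) \<le> ?a * (max 1 (norm (u k)) * (1 + \<rho>))"
    using alpha_pos[of k] by (intro mult_left_mono) auto
  also have "\<dots> = (1 + \<rho>) * \<beta> k" unfolding beta_eq[of k] by (simp add: mult_ac)
  finally have "norm (?a *\<^sub>R (u k + w)) \<le> (1 + \<rho>) * \<beta> k" using alpha_pos[of k] by simp
  then have 6: "(norm (?a *\<^sub>R (u k + w)))\<^sup>2 \<le> ((1 + \<rho>) * \<beta> k)\<^sup>2" by (intro power_mono) auto
  have 7: "2 * ?a * (Fr z - Fr (x k)) = 2 * (?a * (real_of_ereal (f z) - real_of_ereal (f (x k))))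
     + 2 * (?a * real_of_ereal (g z) - ?a * real_of_ereal (g ?y))
     + 2 * (?a * (real_of_ereal (g ?y) - real_of_ereal (g (x k))))"
    by (simp add: Fr_def algebra_simps)
  show ?thesis using 1 2 3 4 5 6 7 by argo
qed

lemma error_summable: "summable (\<lambda>k. ((1 + \<rho>) * \<beta> k)\<^sup>2)"
  using summable_mult[OF beta_sq] by (simp add: power_mult_distrib)

text \<open>Take \<open>z = x k\<close> in \<open>fejer_ineq\<close>: the gap term and the old
  distance vanish.\<close>

lemma step_length: "norm (x k - x (Suc k)) \<le> (1 + \<rho>) * \<beta> k"
proof (rule power2_le_imp_le)
  show "(norm (x k - x (Suc k)))\<^sup>2 \<le> ((1 + \<rho>) * \<beta> k)\<^sup>2"
    using fejer_ineq[OF x_in_dom[of k], of k] by (simp add: norm_minus_commute)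
  show "0 \<le> (1 + \<rho>) * \<beta> k" using rho_nonneg beta_pos[of k] by simp
qed

text \<open>A1 on the intersection of \<open>edom g\<close> with a closed ball bounds the
  subgradients; \<open>\<beta>\<close> is then dominated by a multiple of \<open>\<alpha>\<close>,
  so summability results for \<open>\<alpha>\<close> transfer to \<open>\<beta>\<close>.\<close>

lemma bounded_imp_u_bounded:
  assumes "bounded (range x)"
  shows "\<exists>M>0. \<forall>k. norm (u k) \<le> M \<and> \<beta> k \<le> M * \<alpha> k"
proof -
  obtain R where R: "\<And>k. norm (x k) \<le> R" using assms by (auto simp: bounded_iff)
  have "\<exists>\<zeta>>0. \<forall>z\<in>edom g \<inter> cball 0 R. subdifferential f z \<subseteq> cball 0 \<zeta>"
    by (intro subdiff_f_bounded) (auto simp: closed_dom closed_Int intro: bounded_subset)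
  then obtain \<zeta> where \<zeta>: "\<zeta> > 0" "\<And>z. z \<in> edom g \<inter> cball 0 R \<Longrightarrow> subdifferential f z \<subseteq> cball 0 \<zeta>"
    by blast
  have u: "norm (u k) \<le> max 1 \<zeta>" for k
    using \<zeta>(2)[of "x k"] u_subdiff[of k] x_in_dom[of k] R[of k] by (auto simp: max_def)
  have "\<beta> k \<le> max 1 \<zeta> * \<alpha> k" for k
  proof -
    have "max 1 (norm (u k)) * \<alpha> k \<le> max 1 \<zeta> * \<alpha> k"
      using u[of k] alpha_pos[of k] by (intro mult_right_mono) auto
    then show ?thesis by (simp only: beta_eq)
  qed
  with u show ?thesis by (intro exI[of _ "max 1 \<zeta>"]) auto
qed

text \<open>The shift by \<open>N\<close> admits recursions that hold only from some index
  on.\<close>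

lemma bounded_if_dist_converges:
  assumes "convergent (\<lambda>n. (norm (x (n + N) - z))\<^sup>2)"
  shows "bounded (range x)"
proof -
  obtain B where B: "\<And>n. norm ((norm (x (n + N) - z))\<^sup>2) \<le> B" "B > 0"
    using convergent_imp_Bseq[OF assms] by (auto simp: Bseq_def)
  have "norm (x (n + N)) \<le> norm z + sqrt B" for n
  proof -
    have "norm (x (n + N) - z) \<le> sqrt B" using B(1)[of n] by (intro real_le_rsqrt) simp
    then show ?thesis using norm_triangle_ineq[of z "x (n + N) - z"] by simp
  qed
  then have "Bseq (\<lambda>n. x (n + N))" by (auto intro!: BseqI')
  then have "Bseq x" by (rule Bseq_offset)
  then show ?thesis by (simp add: Bseq_eq_bounded)
qed

section \<open>The lower limit of the values\<close>

lemma INF_le_liminf: "(INF z. F z) \<le> liminf (\<lambda>k. F (x k))"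
  by (intro Liminf_bounded always_eventually allI INF_lower) simp

theorem liminf_eq_INF: "liminf (\<lambda>k. F (x k)) = (INF z. F z)"
proof (rule ccontr)
  assume "liminf (\<lambda>k. F (x k)) \<noteq> (INF z. F z)"
  then have "(INF z. F z) < liminf (\<lambda>k. F (x k))" using INF_le_liminf by auto
  then obtain z where z: "F z < liminf (\<lambda>k. F (x k))" by (auto simp: INF_less_iff)
  \<comment> \<open>A real level in between exists even if the infimum is
    \<open>-\<infinity>\<close> or the lower limit is \<open>\<infinity>\<close>.\<close>
  then obtain c where c: "F z < ereal c" "ereal c < liminf (\<lambda>k. F (x k))"
    using ereal_dense2 by blast
  have zd: "z \<in> edom g" using z by (intro F_finite_imp_dom) auto
  have e: "Fr z < c" using c(1) F_eq_Fr[OF zd] by simp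
  have "eventually (\<lambda>k. ereal c < F (x k)) sequentially"
    using c(2) less_LiminfD by blast
  then obtain N where N: "\<And>k. k \<ge> N \<Longrightarrow> ereal c < F (x k)" by (auto simp: eventually_sequentially)
  have FN: "c < Fr (x (n + N))" for n using N[of "n + N"] F_eq_Fr[OF x_in_dom] by simp
  let ?a = "\<lambda>n. (norm (x (n + N) - z))\<^sup>2" and ?b = "\<lambda>n. ((1 + \<rho>) * \<beta> (n + N))\<^sup>2"
    and ?c = "\<lambda>n. 2 * (c - Fr z) * \<alpha> (n + N)"
  have b: "summable ?b"
    using summable_iff_shift[of "\<lambda>k. ((1 + \<rho>) * \<beta> k)\<^sup>2" N] error_summable by blast
  have c0: "0 \<le> ?c n" for n using e alpha_pos[of "n + N"] by simp
  have le: "?a (Suc n) + ?c n \<le> ?a n + ?b n" for n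
  proof -
    have "\<alpha> (n + N) * (c - Fr z) \<le> \<alpha> (n + N) * (Fr (x (n + N)) - Fr z)"
      using alpha_pos[of "n + N"] FN[of n] by (intro mult_left_mono) auto
    then show ?thesis using fejer_ineq[OF zd, of "n + N"] by (simp add: algebra_simps)
  qed
  have "convergent ?a"
  proof (rule quasi_decreasing_convergent[OF _ _ b])
    show "?a (Suc n) \<le> ?a n + ?b n" for n using le[of n] c0[of n] by linarith
  qed simp
  then obtain M where M: "M > 0" "\<And>k. \<beta> k \<le> M * \<alpha> k"
    using bounded_if_dist_converges bounded_imp_u_bounded by metis
  have "summable ?c" by (rule quasi_decreasing_summable[of ?a, OF _ c0 b le]) simp
  \<comment> \<open>The factor turns the summand into \<open>M * \<alpha> (n + N)\<close>, which
    dominates \<open>\<beta> (n + N)\<close>.\<close>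
  then have "summable (\<lambda>n. M / (2 * (c - Fr z)) * ?c n)" by (rule summable_mult)
  moreover have "M / (2 * (c - Fr z)) * ?c n = M * \<alpha> (n + N)" for n using e by simp
  ultimately have "summable (\<lambda>n. M * \<alpha> (n + N))" by simp
  then have "summable (\<lambda>n. \<beta> (n + N))"
  proof (rule summable_comparison_test')
    show "norm (\<beta> (n + N)) \<le> M * \<alpha> (n + N)" if "n \<ge> 0" for n
      using M(2)[of "n + N"] beta_pos[of "n + N"] by simp
  qed
  then show False using beta_not_summable by (simp add: summable_iff_shift)
qed

section \<open>Weak cluster points and the case without minimizers\<close>

lemma weak_cluster_point_minimizes:
  assumes G: "G \<noteq> bot" "\<And>w. ((\<lambda>k. x k \<bullet> w) \<longlongrightarrow> p \<bullet> w) G"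
    and lim: "((\<lambda>k. F (x k)) \<longlongrightarrow> (INF z. F z)) G"
  shows "p \<in> minimizers F"
proof -
  have "F p \<le> (INF z. F z)"
  proof (rule ccontr)
    assume "\<not> F p \<le> (INF z. F z)"
    then have "(INF z. F z) < F p" by (simp only: not_le)
    then obtain c where c: "(INF z. F z) < ereal c" "ereal c < F p"
      using ereal_dense2 by blast
    \<comment> \<open>The iterates eventually lie in the sublevel set at level \<open>c\<close>,
      which is closed and convex and so contains the weak limit.\<close>
    have "eventually (\<lambda>k. F (x k) < ereal c) G" using lim c(1) by (rule order_tendstoD)
    then have "eventually (\<lambda>k. x k \<in> {z. F z \<le> ereal c}) G" by eventually_elim auto
    then have "p \<in> {z. F z \<le> ereal c}"
      using f g G by (intro weak_limit_in_closed_convex[of _ G x] closed_sublevel_add convex_sublevel_add)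
    with c(2) show False by simp
  qed
  then show ?thesis by (auto simp: minimizers_def intro: order_trans[OF _ INF_lower])
qed

theorem unbounded_if_no_minimizer:
  assumes "minimizers F = {}"
  shows "\<not> bounded (range x)"
proof
  assume "bounded (range x)"
  then obtain R where R: "\<And>k. norm (x k) \<le> R" by (auto simp: bounded_iff)
  obtain r where r: "strict_mono r" "((\<lambda>k. F (x k)) \<circ> r) \<longlonglongrightarrow> liminf (\<lambda>k. F (x k))"
    using liminf_subseq_lim by blast
  \<comment> \<open>The subsequence is encoded as a filter, so that every finer filter supplied by
    weak compactness inherits the limit of the values.\<close>
  define G where "G = filtermap r sequentially"
  have lim: "((\<lambda>k. F (x k)) \<longlongrightarrow> (INF z. F z)) G"
    using r(2) by (simp add: G_def liminf_eq_INF filterlim_filtermap o_def)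
  have "G \<noteq> bot" by (simp add: G_def filtermap_bot_iff)
  then obtain p G' where "G' \<le> G" "G' \<noteq> bot" "\<And>w. ((\<lambda>k. x k \<bullet> w) \<longlongrightarrow> p \<bullet> w) G'"
    using bounded_imp_weak_limit_along_filter[of G x R] R by blast
  then have "p \<in> minimizers F" by (intro weak_cluster_point_minimizes[of G'] tendsto_mono[OF _ lim])
  with assms show False by simp
qed

section \<open>Convergence in the presence of minimizers\<close>

lemma minimizer_in_dom:
  assumes "s \<in> minimizers F"
  shows "s \<in> edom g"
proof (rule F_finite_imp_dom)
  have "F s \<le> F (x 0)" using assms by (simp add: minimizers_def)
  also have "\<dots> < \<infinity>" using F_eq_Fr[OF x_in_dom] by simp
  finally show "F s < \<infinity>" .
qed

lemma minimizer_INF: "s \<in> minimizers F \<Longrightarrow> (INF z. F z) = F s"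
  by (auto simp: minimizers_def intro!: antisym INF_lower INF_greatest)

lemma minimizer_Fr_le:
  assumes "s \<in> minimizers F"
  shows "Fr s \<le> Fr (x k)"
proof -
  have "F s \<le> F (x k)" using assms by (simp add: minimizers_def)
  then show ?thesis
    unfolding F_eq_Fr[OF x_in_dom] F_eq_Fr[OF minimizer_in_dom[OF assms]] by simp
qed

text \<open>With \<open>z = s\<close> the gap term in \<open>fejer_ineq\<close> is nonpositive and
  only the summable error remains.\<close>

lemma dist_minimizer_convergent:
  assumes "s \<in> minimizers F"
  shows "convergent (\<lambda>k. (norm (x k - s))\<^sup>2)"
proof (rule quasi_decreasing_convergent[OF _ _ error_summable])
  show "(norm (x (Suc k) - s))\<^sup>2 \<le> (norm (x k - s))\<^sup>2 + ((1 + \<rho>) * \<beta> k)\<^sup>2" for k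
  proof -
    have "\<alpha> k * (Fr s - Fr (x k)) \<le> 0"
      using minimizer_Fr_le[OF assms, of k] alpha_pos[of k] by (simp add: mult_le_0_iff)
    then show ?thesis using fejer_ineq[OF minimizer_in_dom[OF assms], of k] by linarith
  qed
qed simp

text \<open>
  The squared gaps are quasi-decreasing because one step changes the gap \<open>d\<close> by
  \<open>O(\<beta> k)\<close> and both \<open>\<beta> k * d k\<close> and \<open>(\<beta> k)\<^sup>2\<close> are summable.
\<close>

theorem values_converge:
  assumes s: "s \<in> minimizers F"
  shows "(\<lambda>k. F (x k)) \<longlonglongrightarrow> (INF z. F z)"
proof -
  define d where "d k = Fr (x k) - Fr s" for k
  have d0: "0 \<le> d k" for k using minimizer_Fr_le[OF s] by (simp add: d_def)
  have bnd: "bounded (range x)"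
    using bounded_if_dist_converges[of 0 s] dist_minimizer_convergent[OF s] by simp
  obtain M where M: "M > 0" "\<And>k. norm (u k) \<le> M" "\<And>k. \<beta> k \<le> M * \<alpha> k"
    using bounded_imp_u_bounded[OF bnd] by blast
  have ad0: "0 \<le> 2 * \<alpha> k * d k" for k using d0[of k] alpha_pos[of k] by simp
  have "summable (\<lambda>k. 2 * \<alpha> k * d k)"
  proof (rule quasi_decreasing_summable[of "\<lambda>k. (norm (x k - s))\<^sup>2", OF _ ad0 error_summable])
    show "(norm (x (Suc k) - s))\<^sup>2 + 2 * \<alpha> k * d k \<le> (norm (x k - s))\<^sup>2 + ((1 + \<rho>) * \<beta> k)\<^sup>2" for k
      using fejer_ineq[OF minimizer_in_dom[OF s], of k] by (simp add: d_def algebra_simps)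
  qed simp
  \<comment> \<open>The factor \<open>M / 2\<close> yields \<open>M * \<alpha> k * d k\<close>,
    which dominates \<open>\<beta> k * d k\<close>.\<close>
  then have "summable (\<lambda>k. M / 2 * (2 * \<alpha> k * d k))" by (rule summable_mult)
  then have bd: "summable (\<lambda>k. \<beta> k * d k)"
  proof (rule summable_comparison_test')
    show "norm (\<beta> k * d k) \<le> M / 2 * (2 * \<alpha> k * d k)" if "k \<ge> 0" for k
      using mult_right_mono[OF M(3) d0, of k k] d0[of k] beta_pos[of k] by (simp add: abs_mult mult.assoc)
  qed
  \<comment> \<open>\<open>M\<close> and \<open>\<rho>\<close> bound the increase of
    \<open>f\<close> and \<open>g\<close> per unit of length, and
    \<open>(1 + \<rho>) * \<beta> k\<close> bounds the length of a step.\<close>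
  define D where "D = (M + \<rho>) * (1 + \<rho>)"
  have dstep: "d (Suc k) \<le> d k + D * \<beta> k" for k
  proof -
    have "real_of_ereal (f (x (Suc k))) + u (Suc k) \<bullet> (x k - x (Suc k)) \<le> real_of_ereal (f (x k))"
      using u_subdiff finite_on_dom(1)[OF x_in_dom] finite_on_dom(1)[OF x_in_dom] by (rule subgradient_ineq)
    moreover have "\<bar>u (Suc k) \<bullet> (x k - x (Suc k))\<bar> \<le> M * norm (x k - x (Suc k))"
      using Cauchy_Schwarz_ineq2[of "u (Suc k)" "x k - x (Suc k)"]
        mult_right_mono[OF M(2)[of "Suc k"] norm_ge_zero, of "x k - x (Suc k)"] by linarith
    moreover have "(M + \<rho>) * norm (x k - x (Suc k)) \<le> (M + \<rho>) * ((1 + \<rho>) * \<beta> k)"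
      using M(1) rho_nonneg by (intro mult_left_mono step_length) auto
    ultimately show ?thesis
      using g_lipschitz[OF x_in_dom x_in_dom, of "Suc k" k]
      by (simp add: d_def D_def Fr_def distrib_right mult.assoc)
  qed
  \<comment> \<open>The error \<open>D * \<beta> k\<close> in \<open>dstep\<close> is not summable;
    after squaring, \<open>\<beta> k\<close> occurs only multiplied by \<open>d k\<close> or by
    itself.\<close>
  have "convergent (\<lambda>k. (d k)\<^sup>2)"
  proof (rule quasi_decreasing_convergent)
    show "summable (\<lambda>k. 2 * D * (\<beta> k * d k) + D\<^sup>2 * (\<beta> k)\<^sup>2)"
      by (intro summable_add summable_mult bd beta_sq)
    show "(d (Suc k))\<^sup>2 \<le> (d k)\<^sup>2 + (2 * D * (\<beta> k * d k) + D\<^sup>2 * (\<beta> k)\<^sup>2)" for k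
    proof -
      have "(d (Suc k))\<^sup>2 \<le> (d k + D * \<beta> k)\<^sup>2" using dstep d0 by (intro power_mono)
      then show ?thesis by (simp add: power2_sum power_mult_distrib algebra_simps)
    qed
  qed simp
  then obtain L where "(\<lambda>k. (d k)\<^sup>2) \<longlonglongrightarrow> L" by (auto simp: convergent_def)
  then have "(\<lambda>k. sqrt ((d k)\<^sup>2)) \<longlonglongrightarrow> sqrt L" by (rule tendsto_real_sqrt)
  then have dL: "d \<longlonglongrightarrow> sqrt L" using d0 by simp
  then have "sqrt L = 0" using limit_zero_if_weighted_summable[OF beta_pos beta_not_summable d0 _ bd] by blast
  with dL have "(\<lambda>k. Fr s + d k) \<longlonglongrightarrow> Fr s + 0" by (intro tendsto_intros) simp
  then have "(\<lambda>k. ereal (Fr (x k))) \<longlonglongrightarrow> ereal (Fr s)" by (simp add: d_def)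
  then show ?thesis
    using F_eq_Fr[OF x_in_dom] F_eq_Fr[OF minimizer_in_dom[OF s]] by (simp add: minimizer_INF[OF s])
qed

text \<open>The values converge along the whole sequence, hence along every finer filter, so each
  weak cluster point is a minimizer and Opial's argument applies.\<close>

theorem weak_convergence:
  assumes s: "s \<in> minimizers F"
  shows "\<exists>p\<in>minimizers F. weakly_converges x p"
proof (rule Opial_weak_convergence)
  show "bounded (range x)"
    using bounded_if_dist_converges[of 0 s] dist_minimizer_convergent[OF s] by simp
  show "p \<in> minimizers F"
    if "G \<le> sequentially" "G \<noteq> bot" "\<And>w. ((\<lambda>k. x k \<bullet> w) \<longlongrightarrow> p \<bullet> w) G" for p G
    using that(2,3) tendsto_mono[OF that(1) values_converge[OF s]]
    by (rule weak_cluster_point_minimizes)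
qed (rule dist_minimizer_convergent)

end

theorem theorem2p7:
  fixes f g :: "'a::{real_inner, complete_space} \<Rightarrow> ereal"
    and x u :: "nat \<Rightarrow> 'a"
    and \<alpha> \<beta> :: "nat \<Rightarrow> real"
  assumes nontrivial: "\<exists>z::'a. z \<noteq> 0"
    and f: "proper f" "lsc f" "econvex f"
    and g: "proper g" "lsc g" "econvex g"
    and dom: "edom g \<subseteq> edom f"
    and A1: "\<And>V. V \<subseteq> edom g \<Longrightarrow> bounded V \<Longrightarrow> closed V \<Longrightarrow>
               \<exists>\<zeta>>0. \<forall>z\<in>V. subdifferential f z \<subseteq> cball 0 \<zeta>"
    and A2: "\<exists>\<rho>\<ge>0. \<forall>z\<in>edom g. subdifferential g z \<inter> cball 0 \<rho> \<noteq> {}"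
    and pss: "pss_sequence f g \<alpha> u x"
    and stepsize: "\<And>k. \<alpha> k = \<beta> k / max 1 (norm (u k))"
    and beta_pos: "\<And>k. \<beta> k > 0"
    and beta_sq: "summable (\<lambda>k. (\<beta> k)\<^sup>2)"
    and beta_sum: "(\<Sum>k. ereal (\<beta> k)) = \<infinity>"
  defines "S \<equiv> minimizers (\<lambda>z. f z + g z)"
  shows "liminf (\<lambda>k. f (x k) + g (x k)) = (INF z. f z + g z)
    \<and> (S \<noteq> {} \<longrightarrow>
         ((\<lambda>k. f (x k) + g (x k)) \<longlonglongrightarrow> (INF z. f z + g z)) \<and>
         (\<exists>xbar\<in>S. weakly_converges x xbar))
    \<and> (S = {} \<longrightarrow> \<not> bounded (range x))"
proof -
  obtain \<rho> where \<rho>: "\<rho> \<ge> 0" "\<And>z. z \<in> edom g \<Longrightarrow> subdifferential g z \<inter> cball 0 \<rho> \<noteq> {}"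
    using A2 by blast
  have "\<not> summable \<beta>" using beta_sum suminf_ereal_finite by blast
  then interpret pss_method f g x u \<alpha> \<beta> \<rho>
    using f g dom A1 \<rho> pss stepsize beta_pos beta_sq by unfold_locales
  show ?thesis
    unfolding S_def
  proof (intro conjI impI liminf_eq_INF unbounded_if_no_minimizer)
    assume "minimizers F \<noteq> {}"
    then obtain s where s: "s \<in> minimizers F" by blast
    show "(\<lambda>k. F (x k)) \<longlonglongrightarrow> (INF z. F z)" using s by (rule values_converge)
    show "\<exists>p\<in>minimizers F. weakly_converges x p" using s by (rule weak_convergence)
  qed
qed

end
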